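(* Let $a,b,d$ be positive integers with $a\equiv 1\pmod b$. Let $u=(1+\lfloor i\frac{a}{b}\rfloor)_{i=0}^{db-1}$, and let $\mathcal{PF}_{db}(u)$ be the set of $(da,db)$-parking functions. Then $$\sum_{c\in\mathcal{PF}_{db}(u)}q^{Z(c)}=\sum_{J\in spec(d,b)}\binom{db}{j_1,\ldots,j_d}\,q\left(q+j_1\cdot\frac{a-1}{b}\right)^{j_1-1}\prod_{t=2}^{d}\left(1+j_t\cdot\frac{a-1}{b}\right)^{j_t-1}.$$
   Context: $\mathcal{PF}_{db}(u)$, with $u=(u_0,\ldots,u_{db-1})$, is the set of sequences of positive integers $c=(c_1,\ldots,c_{db})$ whose non-decreasing rearrangement satisfies $c_{(i+1)}\le u_i=1+\lfloor i\frac ab\rfloor$ for $0\le i\le db-1$. $Z(c)$ is the number of entries of $c$ equal to $1$, and $q$ is an indeterminate. $spec(d,b)=\{J=(j_1,\ldots,j_d)\in\mathbb{Z}_{\ge0}^d : j_1+\cdots+j_t\ge tb\text{ for }1\le t\le d,\ j_1+\cdots+j_d=db\}$, and $\binom{db}{j_1,\ldots,j_d}$ is the multinomial coefficient. A factor with $j_t=0$ equals $1$. *)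

theory Defs
  imports
    Complex_Main
    "HOL-Number_Theory.Cong"
    "HOL-Computational_Algebra.Polynomial"
begin

definition parking_functions :: "nat \<Rightarrow> (nat \<Rightarrow> nat) \<Rightarrow> nat list set" where
  "parking_functions n u =
     {c. length c = n \<and> (\<forall>x\<in>set c. 1 \<le> x) \<and> (\<forall>i<n. sort c ! i \<le> u i)}"

definition rational_bound :: "nat \<Rightarrow> nat \<Rightarrow> nat \<Rightarrow> nat" where
  "rational_bound a b i = 1 + nat \<lfloor>real i * (real a / real b)\<rfloor>"

definition ones :: "nat list \<Rightarrow> nat" where
  "ones c = count_list c 1"

(* A list J of length d stands for (j_1,...,j_d), so j_t is J ! (t - 1). *)
definition spec :: "nat \<Rightarrow> nat \<Rightarrow> nat list set" where
  "spec d b =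
     {J. length J = d \<and> (\<forall>t\<in>{1..d}. t * b \<le> sum_list (take t J)) \<and> sum_list J = d * b}"

(* The division is exact when the entries of J add up to n. *)
definition multinomial :: "nat \<Rightarrow> nat list \<Rightarrow> nat" where
  "multinomial n J = fact n div (\<Prod>j\<leftarrow>J. fact j)"

(* Finiteness matters because a sum over an infinite set is 0 by convention. *)
lemma finite_parking_functions: "finite (parking_functions n u)"
proof (rule finite_subset)
  show "parking_functions n u \<subseteq> {c. set c \<subseteq> (\<Union>i<n. {..u i}) \<and> length c = n}"
  proof (clarsimp simp: parking_functions_def)
    fix c x assume *: "\<forall>i<length c. sort c ! i \<le> u i" and "x \<in> set c"
    then have "x \<in> set (sort c)" by simp
    then obtain i where "i < length c" "sort c ! i = x"
      by (metis in_set_conv_nth length_sort)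
    with * show "\<exists>i\<in>{..<length c}. x \<le> u i" by auto
  qed
  show "finite {c. set c \<subseteq> (\<Union>i<n. {..u i}) \<and> length c = n}"
    by (rule finite_lists_length_eq) simp
qed

lemma finite_spec: "finite (spec d b)"
proof (rule finite_subset)
  show "spec d b \<subseteq> {J. set J \<subseteq> {..d * b} \<and> length J = d}"
    using member_le_sum_list by (fastforce simp: spec_def)
  show "finite {J. set J \<subseteq> {..d * b} \<and> length J = d}"
    by (rule finite_lists_length_eq) simp
qed

end

theory Submission
  imports Defs "HOL-Library.FuncSet"
begin

text \<open>
  Write \<open>a = m * b + 1\<close>, so that the bounds are \<open>u i = 1 + i * m + i div b\<close>. Given a map \<open>c\<close> with
  positive values, let \<open>j\<close> be least such that at most \<open>j\<close> values are bounded by \<open>1 + j * m\<close>. Then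
  exactly \<open>j\<close> values are; on their positions \<open>c\<close> is a parking function for the bounds \<open>1 + i * m\<close>,
  and the remaining values, lowered by \<open>1 + j * m\<close>, are again positive. For a parking function
  for \<open>u\<close>, the lowered values satisfy the same kind of condition, with \<open>i div b\<close> replaced by
  \<open>(i + j) div b - 1\<close>, and \<open>j \<ge> b\<close> is forced. Iterating this \<open>d\<close> times cuts \<open>c\<close> into blocks of
  sizes \<open>j\<^sub>1, \<dots>, j\<^sub>d\<close> whose partial sums satisfy the conditions of \<open>spec\<close>, and only the
  first block can contain ones.

  The enumerator \<open>q * (q + n * m) ^ (n - 1)\<close> of a single block of size \<open>n\<close> comes from the same
  decomposition, applied to all maps into \<open>{1..1 + n * m}\<close>, and Abel's binomial identity.
\<close>

section \<open>Abel's identity\<close>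

text \<open>Up to sign this is the \<open>n\<close>-th finite difference with step \<open>h\<close>
  of a power of degree \<open>k < n\<close>. Pascal's rule moves one difference onto the power,
  which lowers the degree and makes the induction hypothesis applicable.\<close>

lemma alternating_sum_choose_power:
  fixes x h :: "'a::comm_ring_1"
  assumes "k < n"
  shows "(\<Sum>j\<le>n. (-1) ^ j * of_nat (n choose j) * (x + of_nat j * h) ^ k) = 0"
  using assms
proof (induction n arbitrary: k)
  case 0
  then show ?case by simp
next
  case (Suc n)
  let ?f = "\<lambda>j. (x + of_nat j * h) ^ k"
  have step: "(\<Sum>j\<le>Suc n. (-1) ^ j * of_nat (Suc n choose j) * ?f j)
      = (\<Sum>j\<le>n. (-1) ^ j * of_nat (n choose j) * (?f j - ?f (Suc j)))"
  proof -
    have "(\<Sum>j\<le>Suc n. (-1) ^ j * of_nat (Suc n choose j) * ?f j)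
        = ?f 0 + (\<Sum>j\<le>n. (-1) ^ Suc j * of_nat (Suc n choose Suc j) * ?f (Suc j))"
      by (subst sum.atMost_Suc_shift) simp
    also have "(\<Sum>j\<le>n. (-1) ^ Suc j * of_nat (Suc n choose Suc j) * ?f (Suc j))
        = (\<Sum>j\<le>n. (-1) ^ Suc j * of_nat (n choose Suc j) * ?f (Suc j))
          - (\<Sum>j\<le>n. (-1) ^ j * of_nat (n choose j) * ?f (Suc j))"
      by (subst sum_subtractf [symmetric]) (intro sum.cong refl, simp add: algebra_simps)
    also have "(\<Sum>j\<le>n. (-1) ^ Suc j * of_nat (n choose Suc j) * ?f (Suc j))
        = (\<Sum>j\<le>Suc n. (-1) ^ j * of_nat (n choose j) * ?f j) - ?f 0"
      by (subst sum.atMost_Suc_shift) (simp del: sum.atMost_Suc)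
    also have "(\<Sum>j\<le>Suc n. (-1) ^ j * of_nat (n choose j) * ?f j)
        = (\<Sum>j\<le>n. (-1) ^ j * of_nat (n choose j) * ?f j)"
      by (simp add: binomial_eq_0)
    finally show ?thesis
      by (simp add: sum_subtractf algebra_simps)
  qed
  \<comment> \<open>In the binomial expansion the top term cancels, so only exponents
    \<open>i < k\<close> remain.\<close>
  have diff: "?f j - ?f (Suc j)
      = (\<Sum>i<k. - of_nat (k choose i) * h ^ (k - i) * (x + of_nat j * h) ^ i)" for j
  proof -
    have "?f (Suc j) = ((x + of_nat j * h) + h) ^ k"
      by (simp add: algebra_simps)
    also have "\<dots> = (\<Sum>i\<le>k. of_nat (k choose i) * (x + of_nat j * h) ^ i * h ^ (k - i))"
      by (rule binomial_ring)
    also have "\<dots> = (\<Sum>i<k. of_nat (k choose i) * (x + of_nat j * h) ^ i * h ^ (k - i)) + ?f j"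
      by (simp flip: lessThan_Suc_atMost)
    finally show ?thesis
      by (simp add: sum_negf mult_ac)
  qed
  have "(\<Sum>j\<le>n. (-1) ^ j * of_nat (n choose j) * (?f j - ?f (Suc j)))
      = (\<Sum>i<k. - of_nat (k choose i) * h ^ (k - i) *
          (\<Sum>j\<le>n. (-1) ^ j * of_nat (n choose j) * (x + of_nat j * h) ^ i))"
    unfolding diff sum_distrib_left
    by (subst sum.swap) (simp add: mult_ac)
  also have "\<dots> = 0"
    by (rule sum.neutral) (use Suc in auto)
  finally show ?case
    using step by simp
qed

text \<open>The case \<open>n = 0\<close> is separate because \<open>n - 1\<close> truncates.\<close>
definition abel_poly :: "'a::comm_ring_1 \<Rightarrow> 'a \<Rightarrow> nat \<Rightarrow> 'a" where
  "abel_poly h x n = (if n = 0 then 1 else x * (x + of_nat n * h) ^ (n - 1))"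

text \<open>Both sides have the same derivative by induction, and at \<open>- x\<close> the left-hand side is
  an \<open>n\<close>-th finite difference of a polynomial of degree \<open>n - 1\<close>.\<close>
lemma abel_identity_poly:
  fixes x h :: "'a::{idom, ring_char_0}"
  shows "(\<Sum>j\<le>n. smult (of_nat (n choose j) * abel_poly h x j) ([:- of_nat j * h, 1:] ^ (n - j)))
           = [:x, 1:] ^ n"
proof (induction n)
  case 0
  then show ?case by (simp add: abel_poly_def)
next
  case (Suc n)
  let ?p = "\<Sum>j\<le>Suc n. smult (of_nat (Suc n choose j) * abel_poly h x j)
                ([:- of_nat j * h, 1:] ^ (Suc n - j))"
  \<comment> \<open>The summand for \<open>j = Suc n\<close> is a constant polynomial and
    disappears.\<close>
  have "pderiv ?p = (\<Sum>j\<le>n. pderiv (smult (of_nat (Suc n choose j) * abel_poly h x j)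
                ([:- of_nat j * h, 1:] ^ (Suc n - j))))"
    by (simp add: higher_pderiv_sum [where n = 1, simplified] pderiv_add pderiv_smult)
  also have "\<dots> = (\<Sum>j\<le>n. smult (of_nat (Suc n))
      (smult (of_nat (n choose j) * abel_poly h x j) ([:- of_nat j * h, 1:] ^ (n - j))))"
  proof (rule sum.cong)
    fix j assume "j \<in> {..n}"
    then have j: "j \<le> n" "Suc n - j = Suc (n - j)" by auto
    have "(Suc n - j) * (Suc n choose j) = Suc n * (n choose j)"
      using binomial_absorb_comp [of "Suc n" j] by simp
    then have "of_nat (Suc n - j) * of_nat (Suc n choose j) = (of_nat (Suc n) * of_nat (n choose j) :: 'a)"
      by (metis of_nat_mult)
    then show "pderiv (smult (of_nat (Suc n choose j) * abel_poly h x j)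
                ([:- of_nat j * h, 1:] ^ (Suc n - j))) = smult (of_nat (Suc n))
      (smult (of_nat (n choose j) * abel_poly h x j) ([:- of_nat j * h, 1:] ^ (n - j)))"
      unfolding j(2) pderiv_smult pderiv_power_Suc
      by (simp del: of_nat_Suc binomial_Suc_Suc add: pderiv_pCons mult_ac)
  qed simp
  also have "\<dots> = smult (of_nat (Suc n)) ([:x, 1:] ^ n)"
    by (subst Suc [symmetric]) (intro poly_eqI, simp add: coeff_sum sum_distrib_left mult.assoc del: of_nat_Suc)
  also have "\<dots> = pderiv ([:x, 1:] ^ Suc n)"
    by (simp only: pderiv_power_Suc) (simp add: pderiv_pCons)
  finally have "pderiv (?p - [:x, 1:] ^ Suc n) = 0"
    by (simp add: pderiv_diff)
  then obtain c where c: "?p - [:x, 1:] ^ Suc n = [:c:]"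
    using pderiv_iszero by blast
  \<comment> \<open>At \<open>- x\<close> the linear factor is minus the base occurring in
    \<open>abel_poly h x j\<close>. The exponents \<open>j - 1\<close> and \<open>Suc n - j\<close>
    then add up to \<open>n\<close> for every \<open>j > 0\<close>; for \<open>j = 0\<close> a
    factor \<open>x\<close> is split off the power instead.\<close>
  have term_eq: "poly (smult (of_nat (Suc n choose j) * abel_poly h x j)
        ([:- of_nat j * h, 1:] ^ (Suc n - j))) (- x)
      = (-1) ^ Suc n * x * ((-1) ^ j * of_nat (Suc n choose j) * (x + of_nat j * h) ^ n)"
    if j: "j \<le> Suc n" for j
  proof -
    have "- x - of_nat j * h = (-1) * (x + of_nat j * h)" by simp
    then have e: "(- x - of_nat j * h) ^ (Suc n - j) = (-1) ^ (Suc n - j) * (x + of_nat j * h) ^ (Suc n - j)"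
      by (metis power_mult_distrib)
    have s: "(-1) ^ (Suc n - j) = ((-1) ^ Suc n * (-1) ^ j :: 'a)"
      using j by (simp add: uminus_power_if)
    have a: "abel_poly h x j * (x + of_nat j * h) ^ (Suc n - j) = x * (x + of_nat j * h) ^ n"
    proof (cases j)
      case 0
      then show ?thesis by (simp add: abel_poly_def)
    next
      case (Suc i)
      then have "(x + of_nat j * h) ^ i * (x + of_nat j * h) ^ (Suc n - j) = (x + of_nat j * h) ^ n"
        using j by (simp flip: power_add)
      then show ?thesis using Suc by (simp add: abel_poly_def mult.assoc)
    qed
    have "poly (smult (of_nat (Suc n choose j) * abel_poly h x j)
        ([:- of_nat j * h, 1:] ^ (Suc n - j))) (- x)
        = of_nat (Suc n choose j) * abel_poly h x j * (- x - of_nat j * h) ^ (Suc n - j)"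
      by (simp add: algebra_simps)
    also have "\<dots> = of_nat (Suc n choose j) * (-1) ^ (Suc n - j)
        * (abel_poly h x j * (x + of_nat j * h) ^ (Suc n - j))"
      unfolding e by (simp only: mult_ac)
    also have "\<dots> = (-1) ^ Suc n * x * ((-1) ^ j * of_nat (Suc n choose j) * (x + of_nat j * h) ^ n)"
      unfolding a s by (simp only: mult_ac)
    finally show ?thesis .
  qed
  have "poly ?p (- x) = (-1) ^ Suc n * x *
     (\<Sum>j\<le>Suc n. (-1) ^ j * of_nat (Suc n choose j) * (x + of_nat j * h) ^ n)"
    unfolding poly_sum sum_distrib_left
    by (rule sum.cong [OF refl]) (rule term_eq, simp)
  also have "\<dots> = 0"
    by (subst alternating_sum_choose_power) auto
  finally have "poly (?p - [:x, 1:] ^ Suc n) (- x) = 0"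
    by simp
  then have "c = 0"
    unfolding c by simp
  then show ?case
    using c by simp
qed

lemma abel_identity:
  fixes x y h :: "'a::{idom, ring_char_0}"
  shows "(\<Sum>j\<le>n. of_nat (n choose j) * abel_poly h x j * (y - of_nat j * h) ^ (n - j)) = (x + y) ^ n"
  using arg_cong [OF abel_identity_poly [of n h x], of "\<lambda>p. poly p y"]
  by (simp add: poly_sum)

section \<open>Counting and sorting\<close>

lemma sum_Pow_card:
  fixes f :: "nat \<Rightarrow> 'b::comm_semiring_1"
  assumes "finite S"
  shows "(\<Sum>T\<in>Pow S. f (card T)) = (\<Sum>j\<le>card S. of_nat (card S choose j) * f j)"
proof -
  have "(\<Sum>T\<in>Pow S. f (card T)) = (\<Sum>j\<le>card S. \<Sum>T | T \<in> Pow S \<and> card T = j. f (card T))"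
    using assms by (intro sum.group [symmetric]) (auto intro: card_mono)
  also have "\<dots> = (\<Sum>j\<le>card S. of_nat (card S choose j) * f j)"
    using assms by (intro sum.cong refl) (simp add: n_subsets)
  finally show ?thesis .
qed

lemma sorted_nth_le_iff:
  fixes xs :: "'a::linorder list"
  assumes "sorted xs" "i < length xs"
  shows "xs ! i \<le> y \<longleftrightarrow> i < length (filter (\<lambda>x. x \<le> y) xs)"
  using assms
proof (induction xs arbitrary: i)
  case Nil
  then show ?case by simp
next
  case (Cons x xs)
  show ?case
  proof (cases "x \<le> y")
    case True
    then show ?thesis using Cons by (cases i) auto
  next
    case False
    then have "\<forall>z\<in>set (x # xs). \<not> z \<le> y"
      using Cons.prems by auto
    moreover have "(x # xs) ! i \<in> set (x # xs)"
      using Cons.prems(2) by (rule nth_mem)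
    ultimately show ?thesis
      by (metis (no_types, lifting) filter_False list.size(3) not_less_zero)
  qed
qed

text \<open>Replaces sorting by counting, which makes sense for maps on any finite set of
  positions.\<close>

lemma sort_nth_le_iff:
  fixes xs :: "'a::linorder list"
  assumes "i < length xs"
  shows "sort xs ! i \<le> y \<longleftrightarrow> i < card {k. k < length xs \<and> xs ! k \<le> y}"
  using assms sorted_nth_le_iff [of "sort xs" i y]
  by (simp add: filter_sort length_filter_conv_card)

text \<open>Matches choosing the positions of the first block and then distributing the rest. Since
  \<open>multinomial\<close> is defined by \<open>div\<close>, exactness of the division comes
  first; then the product of factorials cancels.\<close>

lemma multinomial_Cons:
  "multinomial (sum_list (i # J)) (i # J) = (sum_list (i # J) choose i) * multinomial (sum_list J) J"
proof -
  have pos: "(\<Prod>j\<leftarrow>J. fact j) > (0::nat)" for J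
    by (induction J) auto
  have dvd: "(\<Prod>j\<leftarrow>J. fact j) dvd (fact (sum_list J) :: nat)" for J
  proof (induction J)
    case Nil
    then show ?case by simp
  next
    case (Cons i J)
    then have "fact i * (\<Prod>j\<leftarrow>J. fact j) dvd (fact i * fact (sum_list J) :: nat)"
      by simp
    also have "\<dots> dvd fact (i + sum_list J)"
      using choose_dvd [of i "i + sum_list J", where ?'a = nat] by simp
    finally show ?case by simp
  qed
  have eq: "fact (sum_list J) = multinomial (sum_list J) J * (\<Prod>j\<leftarrow>J. fact j)" for J
    using dvd by (simp add: multinomial_def)
  have "multinomial (sum_list (i # J)) (i # J) * (\<Prod>j\<leftarrow>i # J. fact j)
      = fact i * fact (sum_list J) * (sum_list (i # J) choose i)"
    using binomial_fact_lemma [of i "sum_list (i # J)"] eq [of "i # J"] by simp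
  also have "\<dots> = (sum_list (i # J) choose i) * multinomial (sum_list J) J * (\<Prod>j\<leftarrow>i # J. fact j)"
    using eq [of J] by (simp add: mult_ac)
  finally show ?thesis
    using pos [of "i # J"] by (metis mult_right_cancel less_numeral_extra(3))
qed

section \<open>Parking prefixes\<close>

text \<open>The \<open>i\<close>-th smallest value, counted from \<open>0\<close>, is at most \<open>1 + i * m + v i\<close> iff more than \<open>i\<close>
  elements have a value below this bound.\<close>
definition parking_maps :: "nat \<Rightarrow> (nat \<Rightarrow> nat) \<Rightarrow> 'a set \<Rightarrow> ('a \<Rightarrow> nat) set" where
  "parking_maps m v S = {c \<in> S \<rightarrow>\<^sub>E {1..}. \<forall>i<card S. i < card {s \<in> S. c s \<le> 1 + i * m + v i}}"

lemma parking_maps_subset: "parking_maps m v S \<subseteq> S \<rightarrow>\<^sub>E {1..}"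
  by (auto simp: parking_maps_def)

text \<open>The condition at \<open>i = card S - 1\<close> asks for \<open>card S\<close> elements
  below the last bound, hence for all of them.\<close>

lemma parking_maps_le:
  assumes "finite S" "c \<in> parking_maps m v S" "s \<in> S"
  shows "c s \<le> 1 + (card S - 1) * m + v (card S - 1)"
proof -
  let ?i = "card S - 1"
  have "card S > 0"
    using assms by (auto simp: card_gt_0_iff)
  then have "?i < card S" by simp
  then have "?i < card {s \<in> S. c s \<le> 1 + ?i * m + v ?i}"
    using assms(2) unfolding parking_maps_def by blast
  then have "card S \<le> card {s \<in> S. c s \<le> 1 + ?i * m + v ?i}"
    by linarith
  then have "{s \<in> S. c s \<le> 1 + ?i * m + v ?i} = S"
    by (intro card_seteq) (use assms in auto)
  with assms(3) show ?thesis by blast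
qed

lemma finite_parking_maps:
  assumes "finite S"
  shows "finite (parking_maps m v S)"
proof (rule finite_subset)
  show "parking_maps m v S \<subseteq> S \<rightarrow>\<^sub>E {..1 + (card S - 1) * m + v (card S - 1)}"
    using parking_maps_le [OF assms] by (auto intro!: PiE_I simp: parking_maps_def intro: PiE_arb)
qed (intro finite_PiE assms finite_atMost)

lemma parking_maps_empty [simp]: "parking_maps m v {} = {\<lambda>_. undefined}"
  by (simp add: parking_maps_def)

definition parking_prefix :: "nat \<Rightarrow> 'a set \<Rightarrow> ('a \<Rightarrow> nat) \<Rightarrow> 'a set \<Rightarrow> bool" where
  "parking_prefix m S c T \<longleftrightarrow> T \<subseteq> S \<and> restrict c T \<in> parking_maps m (\<lambda>_. 0) T \<and>
     (\<forall>s\<in>S - T. 1 + card T * m < c s)"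

text \<open>Values on \<open>T\<close> are at most \<open>1 + card T * m\<close> and all others
  exceed it, so the size of a prefix determines the prefix.\<close>

lemma parking_prefix_eq:
  assumes "finite S" "parking_prefix m S c T"
  shows "T = {s \<in> S. c s \<le> 1 + card T * m}"
proof
  have "finite T"
    using assms by (auto simp: parking_prefix_def intro: finite_subset)
  show "T \<subseteq> {s \<in> S. c s \<le> 1 + card T * m}"
  proof
    fix s assume s: "s \<in> T"
    then have "c s \<le> 1 + (card T - 1) * m"
      using parking_maps_le [OF \<open>finite T\<close>, of "restrict c T" m "\<lambda>_. 0" s] assms(2)
      by (simp add: parking_prefix_def)
    also have "\<dots> \<le> 1 + card T * m" by simp
    finally show "s \<in> {s \<in> S. c s \<le> 1 + card T * m}"
      using s assms(2) by (auto simp: parking_prefix_def)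
  qed
  show "{s \<in> S. c s \<le> 1 + card T * m} \<subseteq> T"
    using assms(2) unfolding parking_prefix_def by (auto simp flip: not_less)
qed

text \<open>If \<open>U\<close> were larger, its parking condition at index \<open>card T\<close>
  would give more than \<open>card T\<close> values up to \<open>1 + card T * m\<close>, but
  \<open>T\<close> contains all such positions.\<close>

lemma parking_prefix_card_le:
  assumes "finite S" "parking_prefix m S c T" "parking_prefix m S c U"
  shows "card U \<le> card T"
proof (rule ccontr)
  assume "\<not> card U \<le> card T"
  then have "card T < card {s \<in> U. restrict c U s \<le> 1 + card T * m}"
    using assms(3) by (simp add: parking_prefix_def parking_maps_def)
  also have "{s \<in> U. restrict c U s \<le> 1 + card T * m} \<subseteq> {s \<in> S. c s \<le> 1 + card T * m}"
    using assms(3) by (auto simp: parking_prefix_def)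
  then have "card {s \<in> U. restrict c U s \<le> 1 + card T * m} \<le> card {s \<in> S. c s \<le> 1 + card T * m}"
    using assms(1) by (intro card_mono) auto
  also have "{s \<in> S. c s \<le> 1 + card T * m} = T"
    using parking_prefix_eq [OF assms(1,2)] by simp
  finally show False by simp
qed

lemma parking_prefix_unique:
  assumes "finite S" "parking_prefix m S c T" "parking_prefix m S c U"
  shows "T = U"
proof -
  have "card T = card U"
    using assms by (intro antisym parking_prefix_card_le)
  then show ?thesis
    using parking_prefix_eq [OF assms(1,2)] parking_prefix_eq [OF assms(1,3)] by simp
qed

text \<open>The prefix stops at the first \<open>j\<close> for which at most \<open>j\<close> values are bounded by \<open>1 + j * m\<close>.\<close>
lemma parking_prefix_exists:
  assumes "finite S" "c \<in> S \<rightarrow>\<^sub>E {1..}"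
  shows "\<exists>T. parking_prefix m S c T"
proof -
  let ?A = "\<lambda>i. {s \<in> S. c s \<le> 1 + i * m}"
  define j where "j = (LEAST i. card (?A i) \<le> i)"
  have fin: "finite (?A i)" for i
    using assms(1) by simp
  have "card (?A (card S)) \<le> card S"
    using assms(1) by (intro card_mono) auto
  then have le: "card (?A j) \<le> j"
    unfolding j_def by (rule LeastI)
  have less: "i < card (?A i)" if "i < j" for i
    using not_less_Least [of i "\<lambda>i. card (?A i) \<le> i"] that by (simp add: j_def)
  \<comment> \<open>The sets \<open>?A i\<close> grow with \<open>i\<close>, so minimality at
    \<open>j - 1\<close> already supplies \<open>j\<close> elements.\<close>
  have "j \<le> card (?A j)"
  proof (cases j)
    case (Suc i)
    then have "i < card (?A i)"
      using less by simp
    also have "\<dots> \<le> card (?A j)"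
      using Suc by (intro card_mono fin) auto
    finally show ?thesis using Suc by simp
  qed simp
  with le have card: "card (?A j) = j" by simp
  have "restrict c (?A j) \<in> parking_maps m (\<lambda>_. 0) (?A j)"
  proof -
    have "{s \<in> ?A j. restrict c (?A j) s \<le> 1 + i * m} = ?A i" if "i < j" for i
    proof -
      have "c s \<le> 1 + j * m" if "c s \<le> 1 + i * m" for s
        using that mult_le_mono1 [of i j m] \<open>i < j\<close> by linarith
      then show ?thesis by auto
    qed
    moreover have "restrict c (?A j) \<in> ?A j \<rightarrow>\<^sub>E {1..}"
      using assms(2) by (auto simp: PiE_iff)
    ultimately show ?thesis
      using less unfolding parking_maps_def card by simp
  qed
  then have "parking_prefix m S c (?A j)"
    unfolding parking_prefix_def card by auto
  then show ?thesis ..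
qed

section \<open>Cutting a map into its prefix and the lowered remainder\<close>

definition glue :: "nat \<Rightarrow> 'a set \<Rightarrow> 'a set \<Rightarrow> ('a \<Rightarrow> nat) \<Rightarrow> ('a \<Rightarrow> nat) \<Rightarrow> 'a \<Rightarrow> nat" where
  "glue k S T f g = (\<lambda>s\<in>S. if s \<in> T then f s else g s + k)"

lemma restrict_glue_left:
  assumes "T \<subseteq> S" "f \<in> extensional T"
  shows "restrict (glue k S T f g) T = f"
proof
  fix s
  show "restrict (glue k S T f g) T s = f s"
    using assms(1) extensional_arb [OF assms(2), of s] by (cases "s \<in> T") (auto simp: glue_def)
qed

lemma restrict_glue_right:
  assumes "g \<in> extensional (S - T)"
  shows "restrict (\<lambda>s. glue k S T f g s - k) (S - T) = g"
proof
  fix s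
  show "restrict (\<lambda>s. glue k S T f g s - k) (S - T) s = g s"
    using extensional_arb [OF assms, of s] by (cases "s \<in> S - T") (auto simp: glue_def)
qed

text \<open>This is \<open>q\<close> to the number of ones, written as a product so that it factors
  over positions.\<close>

definition ones_weight :: "'b::comm_semiring_1 \<Rightarrow> 'a set \<Rightarrow> ('a \<Rightarrow> nat) \<Rightarrow> 'b" where
  "ones_weight q S c = (\<Prod>s\<in>S. if c s = 1 then q else 1)"

lemma ones_weight_one [simp]: "ones_weight 1 S c = 1"
  by (simp add: ones_weight_def)

lemma ones_weight_glue:
  assumes "finite S" "T \<subseteq> S" "k > 0" "g \<in> (S - T) \<rightarrow>\<^sub>E {1..}"
  shows "ones_weight q S (glue k S T f g) = ones_weight q T f"
proof -
  have "ones_weight q S (glue k S T f g)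
      = (\<Prod>s\<in>S - T. if glue k S T f g s = 1 then q else 1) * (\<Prod>s\<in>T. if glue k S T f g s = 1 then q else 1)"
    unfolding ones_weight_def by (rule prod.subset_diff [OF assms(2,1)])
  also have "(\<Prod>s\<in>S - T. if glue k S T f g s = 1 then q else 1) = 1"
  proof (intro prod.neutral ballI)
    fix s assume "s \<in> S - T"
    then have "glue k S T f g s = g s + k" "1 \<le> g s"
      using assms(4) by (auto simp: glue_def)
    then show "(if glue k S T f g s = 1 then q else 1) = 1"
      using assms(3) by simp
  qed
  also have "(\<Prod>s\<in>T. if glue k S T f g s = 1 then q else 1) = ones_weight q T f"
    unfolding ones_weight_def using assms(2) by (intro prod.cong) (auto simp: glue_def)
  finally show ?thesis by simp
qed

text \<open>Each map corresponds to exactly one triple of prefix positions, prefix values and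
  lowered remainder. Only the prefix carries ones, so the remainders are merely counted.
  \<open>F\<close> and \<open>G\<close> stay abstract to cover both all maps into an interval and
  parking maps for general \<open>v\<close>.\<close>

lemma sum_ones_weight_decompose:
  fixes q :: "'b::comm_semiring_1" and m :: nat
  defines "P \<equiv> parking_maps m (\<lambda>_. 0)"
  assumes fin: "finite S" and F: "F \<subseteq> S \<rightarrow>\<^sub>E {1..}"
    and G: "\<And>T. T \<subseteq> S \<Longrightarrow> G T \<subseteq> (S - T) \<rightarrow>\<^sub>E {1..}" "\<And>T. T \<subseteq> S \<Longrightarrow> finite (G T)"
    and iff: "\<And>T f g. T \<subseteq> S \<Longrightarrow> f \<in> P T \<Longrightarrow> g \<in> (S - T) \<rightarrow>\<^sub>E {1..} \<Longrightarrow>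
      glue (1 + card T * m) S T f g \<in> F \<longleftrightarrow> g \<in> G T"
  shows "(\<Sum>c\<in>F. ones_weight q S c)
    = (\<Sum>T\<in>Pow S. (\<Sum>f\<in>P T. ones_weight q T f) * of_nat (card (G T)))"
proof -
  define decomp where "decomp c = (let T = (THE T. parking_prefix m S c T)
    in (T, restrict c T, restrict (\<lambda>s. c s - (1 + card T * m)) (S - T)))" for c
  define join where "join = (\<lambda>(T, f, g). glue (1 + card T * m) S T f g)"
  have the: "(THE T. parking_prefix m S c T) = T" if "parking_prefix m S c T" for c T
    using that parking_prefix_unique [OF fin] by (intro the_equality)
  \<comment> \<open>Lifted values are positive before the shift, so they lie strictly above the
    prefix bound; hence \<open>decomp\<close> recovers \<open>T\<close> from a glued map.\<close>
  have prefix: "parking_prefix m S (glue (1 + card T * m) S T f g) T"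
    if "T \<subseteq> S" "f \<in> P T" "g \<in> (S - T) \<rightarrow>\<^sub>E {1..}" for T f g
  proof -
    have "restrict (glue (1 + card T * m) S T f g) T = f"
      using that by (intro restrict_glue_left) (auto simp: P_def parking_maps_def PiE_iff)
    moreover have "1 + card T * m < glue (1 + card T * m) S T f g s" if s: "s \<in> S - T" for s
    proof -
      have "1 \<le> g s" using s \<open>g \<in> _\<close> by auto
      then show ?thesis using s by (simp add: glue_def)
    qed
    ultimately show ?thesis
      using that by (simp add: parking_prefix_def P_def)
  qed
  have "(\<Sum>c\<in>F. ones_weight q S c)
      = (\<Sum>(T, f, g)\<in>(SIGMA T:Pow S. P T \<times> G T). ones_weight q T f)"
  proof (rule sum.reindex_bij_witness [where i = join and j = decomp])
    fix c assume c: "c \<in> F"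
    then have c': "c \<in> S \<rightarrow>\<^sub>E {1..}"
      using F by auto
    obtain T where T: "parking_prefix m S c T"
      using parking_prefix_exists [OF fin c'] by blast
    let ?f = "restrict c T" and ?g = "restrict (\<lambda>s. c s - (1 + card T * m)) (S - T)"
    have decomp: "decomp c = (T, ?f, ?g)"
      by (simp add: decomp_def the [OF T])
    have TS: "T \<subseteq> S" and f: "?f \<in> P T" and big: "\<forall>s\<in>S - T. 1 + card T * m < c s"
      using T by (auto simp: parking_prefix_def P_def)
    have g: "?g \<in> (S - T) \<rightarrow>\<^sub>E {1..}"
    proof (rule restrict_PiE_iff [THEN iffD2], rule ballI)
      fix s assume "s \<in> S - T"
      then show "c s - (1 + card T * m) \<in> {1..}"
        using big by (simp add: Suc_le_eq)
    qed
    have join: "glue (1 + card T * m) S T ?f ?g = c"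
    proof
      fix s
      show "glue (1 + card T * m) S T ?f ?g s = c s"
        using big TS PiE_arb [OF c', of s] less_imp_le [of "1 + card T * m" "c s"]
        by (cases "s \<in> S"; cases "s \<in> T") (auto simp: glue_def)
    qed
    show "join (decomp c) = c"
      by (simp only: decomp join_def prod.case join)
    show "decomp c \<in> (SIGMA T:Pow S. P T \<times> G T)"
      using iff [OF TS f g] c f TS unfolding decomp join by simp
    show "(case decomp c of (T, f, g) \<Rightarrow> ones_weight q T f) = ones_weight q S c"
      using ones_weight_glue [OF fin TS _ g, of "1 + card T * m" q ?f] unfolding decomp join by simp
  next
    fix x assume "x \<in> (SIGMA T:Pow S. P T \<times> G T)"
    then obtain T f g where x: "x = (T, f, g)" and TS: "T \<subseteq> S" and f: "f \<in> P T" and g: "g \<in> G T"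
      by auto
    have g': "g \<in> (S - T) \<rightarrow>\<^sub>E {1..}"
      using g G(1) [OF TS] by auto
    show "join x \<in> F"
      using iff [OF TS f g'] g by (simp add: x join_def)
    have "restrict (glue (1 + card T * m) S T f g) T = f"
      using TS f by (intro restrict_glue_left) (auto simp: P_def parking_maps_def PiE_iff)
    moreover have "restrict (\<lambda>s. glue (1 + card T * m) S T f g s - (1 + card T * m)) (S - T) = g"
      using g' by (intro restrict_glue_right) (auto simp: PiE_iff)
    ultimately show "decomp (join x) = x"
      unfolding x join_def prod.case decomp_def the [OF prefix [OF TS f g']] Let_def by simp
  qed
  also have "\<dots> = (\<Sum>T\<in>Pow S. \<Sum>(f, g)\<in>P T \<times> G T. ones_weight q T f)"
    using fin G(2) by (subst sum.Sigma) (auto simp: P_def finite_parking_maps [OF finite_subset])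
  also have "\<dots> = (\<Sum>T\<in>Pow S. (\<Sum>f\<in>P T. ones_weight q T f) * of_nat (card (G T)))"
    unfolding sum_distrib_right
    by (simp flip: sum.cartesian_product add: mult.commute)
  finally show ?thesis .
qed

section \<open>The enumerator of a single block\<close>

lemma sum_ones_weight_PiE:
  fixes q :: "'b::comm_semiring_1"
  assumes "finite S"
  shows "(\<Sum>c\<in>S \<rightarrow>\<^sub>E {1..1 + k}. ones_weight q S c) = (q + of_nat k) ^ card S"
proof -
  have "(\<Sum>c\<in>S \<rightarrow>\<^sub>E {1..1 + k}. ones_weight q S c) = (\<Prod>s\<in>S. \<Sum>i\<in>{1..1 + k}. if i = 1 then q else 1)"
    unfolding ones_weight_def using assms by (subst prod_sum_PiE) auto
  also have "(\<Sum>i\<in>{1..1 + k}. if i = 1 then q else (1::'b)) = q + of_nat k"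
    by (subst sum.atLeast_Suc_atMost) (auto intro!: sum.cong simp: if_distrib)
  finally show ?thesis by simp
qed

text \<open>Splitting the parking prefix off an arbitrary map into \<open>{1..1 + n * m}\<close> yields the recursion
  that Abel's identity solves.\<close>
lemma sum_ones_weight_parking_maps:
  fixes q :: "'b::{idom, ring_char_0}"
  assumes "finite S"
  shows "(\<Sum>c\<in>parking_maps m (\<lambda>_. 0) S. ones_weight q S c) = abel_poly (of_nat m) q (card S)"
  using assms
proof (induction "card S" arbitrary: S rule: less_induct)
  case less
  let ?n = "card S"
  let ?P = "parking_maps m (\<lambda>_. 0) :: 'a set \<Rightarrow> _"
  let ?G = "\<lambda>T. (S - T) \<rightarrow>\<^sub>E {1..(?n - card T) * m}"
  let ?B = "\<lambda>T. \<Sum>f\<in>?P T. ones_weight q T f"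
  let ?A = "abel_poly (of_nat m) q"
  let ?R = "\<lambda>k. (of_nat ?n * of_nat m - of_nat k * of_nat m :: 'b) ^ (?n - k)"
  have "(\<Sum>c\<in>S \<rightarrow>\<^sub>E {1..1 + ?n * m}. ones_weight q S c) = (\<Sum>T\<in>Pow S. ?B T * of_nat (card (?G T)))"
  proof (rule sum_ones_weight_decompose [OF less(2)])
    fix T :: "'a set" and f g :: "'a \<Rightarrow> nat"
    assume T: "T \<subseteq> S" and f: "f \<in> ?P T" and g: "g \<in> (S - T) \<rightarrow>\<^sub>E {1..}"
    have card: "card T \<le> ?n" and finT: "finite T"
      using T less(2) by (auto intro: card_mono finite_subset)
    have split: "?n * m = card T * m + (?n - card T) * m"
      using card by (simp flip: add_mult_distrib)
    have "f s \<in> {1..1 + ?n * m}" if "s \<in> T" for s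
    proof -
      have "f s \<le> 1 + (card T - 1) * m"
        using parking_maps_le [OF finT f that] by simp
      also have "\<dots> \<le> 1 + ?n * m"
        using card by (auto intro!: mult_le_mono1)
      finally show ?thesis
        using f that by (auto simp: parking_maps_def PiE_iff)
    qed
    then show "glue (1 + card T * m) S T f g \<in> S \<rightarrow>\<^sub>E {1..1 + ?n * m} \<longleftrightarrow> g \<in> ?G T"
      using g T unfolding split by (auto simp: glue_def PiE_iff)
  qed (use less(2) in \<open>auto simp: PiE_iff intro!: finite_PiE\<close>)
  \<comment> \<open>\<open>card T <= ?n\<close> turns the truncated subtraction into subtraction in
    the ring.\<close>
  also have "\<dots> = (\<Sum>T\<in>Pow S. ?B T * ?R (card T))"
  proof (intro sum.cong refl)
    fix T assume "T \<in> Pow S"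
    then have T: "T \<subseteq> S" "finite T" "card T \<le> ?n"
      using less(2) by (auto intro: card_mono finite_subset)
    then show "?B T * of_nat (card (?G T)) = ?B T * ?R (card T)"
      using less(2) by (simp add: card_PiE card_Diff_subset of_nat_diff left_diff_distrib)
  qed
  also have "\<dots> = ?B S + (\<Sum>T\<in>Pow S - {S}. ?A (card T) * ?R (card T))"
  proof -
    have "?B T = ?A (card T)" if "T \<in> Pow S - {S}" for T
      using that less psubset_card_mono [of S T] by (auto intro: finite_subset)
    then show ?thesis
      using less(2) by (simp add: sum.remove [of "Pow S" S])
  qed
  finally have "?B S + (\<Sum>T\<in>Pow S - {S}. ?A (card T) * ?R (card T)) = (q + of_nat ?n * of_nat m) ^ ?n"
    using sum_ones_weight_PiE [OF less(2), of q "?n * m"] by simp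
  \<comment> \<open>Abel's identity at \<open>y = ?n * m\<close> gives the same total with
    \<open>?A\<close> throughout. The terms for proper subsets agree by induction, so cancelling
    them leaves the claim for \<open>S\<close>.\<close>
  also have "\<dots> = (\<Sum>j\<le>?n. of_nat (?n choose j) * (?A j * ?R j))"
    using abel_identity [of ?n "of_nat m" q "of_nat ?n * of_nat m"] by (simp add: mult.assoc)
  also have "\<dots> = (\<Sum>T\<in>Pow S. ?A (card T) * ?R (card T))"
    using sum_Pow_card [OF less(2), of "\<lambda>j. ?A j * ?R j"] by simp
  also have "\<dots> = ?A ?n + (\<Sum>T\<in>Pow S - {S}. ?A (card T) * ?R (card T))"
    using less(2) by (simp add: sum.remove [of "Pow S" S])
  finally show ?case by simp
qed

section \<open>Recursion for bounds raised by \<open>v\<close>\<close>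

text \<open>Conditions at indices below \<open>card T\<close> already hold for \<open>f\<close>. At
  \<open>i + card T\<close> all of \<open>T\<close> is counted, and lowering the bound by
  \<open>1 + card T * m\<close> leaves \<open>i * m + v (i + card T)\<close>; one unit of
  \<open>v\<close> becomes the leading \<open>1\<close> of the new bound.\<close>

lemma glue_in_parking_maps_iff:
  assumes fin: "finite S" and v: "mono v" and T: "T \<subseteq> S" "T = S \<or> 1 \<le> v (card T)"
    and f: "f \<in> parking_maps m (\<lambda>_. 0) T" and g: "g \<in> (S - T) \<rightarrow>\<^sub>E {1..}"
  shows "glue (1 + card T * m) S T f g \<in> parking_maps m v S
    \<longleftrightarrow> g \<in> parking_maps m (\<lambda>i. v (i + card T) - 1) (S - T)"
proof -
  let ?k = "card T" and ?c = "glue (1 + card T * m) S T f g"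
  let ?A = "\<lambda>i. {s \<in> S. ?c s \<le> 1 + i * m + v i}"
  let ?B = "\<lambda>i. {s \<in> S - T. g s \<le> 1 + i * m + (v (i + ?k) - 1)}"
  have finT: "finite T" using fin T by (auto intro: finite_subset)
  have cardS: "card S = card (S - T) + ?k"
    using card_Diff_subset [OF finT T(1)] card_mono [OF fin T(1)] by simp
  have c: "?c \<in> S \<rightarrow>\<^sub>E {1..}"
    using f g by (auto simp: glue_def parking_maps_def PiE_iff)
  have small: "i < card (?A i)" if "i < ?k" for i
  proof -
    have "i < card {s \<in> T. f s \<le> 1 + i * m}"
      using f that by (simp add: parking_maps_def)
    also have "\<dots> \<le> card (?A i)"
      using fin T(1) by (intro card_mono) (auto simp: glue_def)
    finally show ?thesis .
  qed
  have large: "card (?A (i + ?k)) = card (?B i) + ?k" if "i < card (S - T)" for i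
  proof -
    have "T \<noteq> S" using that by auto
    \<comment> \<open>Monotonicity carries positivity of \<open>v\<close> to all later indices, so
      the subtraction of \<open>1\<close> is not truncated.\<close>
    then have v1: "1 \<le> v (i + ?k)"
      using T(2) monoD [OF v, of ?k "i + ?k"] by simp
    have fT: "f s \<le> 1 + (i + ?k) * m + v (i + ?k)" if "s \<in> T" for s
    proof -
      have "f s \<le> 1 + (?k - 1) * m"
        using parking_maps_le [OF finT f that] by simp
      also have "(?k - 1) * m \<le> (i + ?k) * m"
        by (intro mult_le_mono1) simp
      finally show ?thesis by simp
    qed
    have eqv: "g s + (1 + ?k * m) \<le> 1 + (i + ?k) * m + v (i + ?k) \<longleftrightarrow> g s \<le> 1 + i * m + (v (i + ?k) - 1)" for s
      using v1 by (simp add: add_mult_distrib)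
    have "?A (i + ?k) = ?B i \<union> T"
      unfolding set_eq_iff
    proof
      fix s
      show "s \<in> ?A (i + ?k) \<longleftrightarrow> s \<in> ?B i \<union> T"
        using fT [of s] eqv [of s] T(1) by (cases "s \<in> T"; cases "s \<in> S") (auto simp: glue_def)
    qed
    also have "card \<dots> = card (?B i) + ?k"
      using fin finT by (intro card_Un_disjoint) auto
    finally show ?thesis .
  qed
  have "(\<forall>i<card S. i < card (?A i)) \<longleftrightarrow> (\<forall>i<card (S - T). i < card (?B i))"
  proof safe
    fix i assume *: "\<forall>i<card S. i < card (?A i)" and i: "i < card (S - T)"
    then have "i + ?k < card (?A (i + ?k))"
      using cardS by (metis add_less_cancel_right)
    then show "i < card (?B i)"
      using large [OF i] by simp
  next
    fix i assume *: "\<forall>i<card (S - T). i < card (?B i)" and i: "i < card S"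
    show "i < card (?A i)"
    proof (cases "i < ?k")
      case False
      then obtain i' where i': "i = i' + ?k"
        by (metis add.commute le_Suc_ex not_le)
      then have "i' < card (S - T)" using i cardS by simp
      then show ?thesis using * large [of i'] i' by simp
    qed (rule small)
  qed
  then show ?thesis
    using c g by (simp add: parking_maps_def)
qed

text \<open>The condition at index \<open>card T\<close> asks for more than \<open>card T\<close>
  values up to \<open>1 + card T * m\<close>, but only positions in \<open>T\<close> can have them.
  This is the source of the lower bounds on partial sums in \<open>spec\<close>.\<close>

lemma glue_notin_parking_maps:
  assumes fin: "finite S" and T: "T \<subseteq> S" "T \<noteq> S" and v: "v (card T) = 0"
    and g: "g \<in> (S - T) \<rightarrow>\<^sub>E {1..}"
  shows "glue (1 + card T * m) S T f g \<notin> parking_maps m v S"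
proof
  assume "glue (1 + card T * m) S T f g \<in> parking_maps m v S"
  moreover have "card T < card S"
    using fin T by (intro psubset_card_mono) auto
  ultimately have "card T < card {s \<in> S. glue (1 + card T * m) S T f g s \<le> 1 + card T * m + v (card T)}"
    by (simp add: parking_maps_def)
  also have "\<dots> \<le> card T"
  proof (rule card_mono)
    show "finite T" using fin T by (auto intro: finite_subset)
    show "{s \<in> S. glue (1 + card T * m) S T f g s \<le> 1 + card T * m + v (card T)} \<subseteq> T"
    proof
      fix s assume "s \<in> {s \<in> S. glue (1 + card T * m) S T f g s \<le> 1 + card T * m + v (card T)}"
      moreover have "1 \<le> g s" if "s \<in> S - T"
        using g that by auto
      ultimately show "s \<in> T"
        by (cases "s \<in> T") (auto simp: glue_def v)
    qed
  qed
  finally show False by simp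
qed

lemma sum_ones_weight_parking_maps_rec:
  fixes q :: "'b::{idom, ring_char_0}"
  assumes fin: "finite S" and v: "mono v"
  shows "(\<Sum>c\<in>parking_maps m v S. ones_weight q S c)
    = (\<Sum>T | T \<subseteq> S \<and> (T = S \<or> 1 \<le> v (card T)). abel_poly (of_nat m) q (card T) *
        of_nat (card (parking_maps m (\<lambda>i. v (i + card T) - 1) (S - T))))"
proof -
  let ?ok = "\<lambda>T. T = S \<or> 1 \<le> v (card T)"
  let ?G = "\<lambda>T. if ?ok T then parking_maps m (\<lambda>i. v (i + card T) - 1) (S - T) else {}"
  have "(\<Sum>c\<in>parking_maps m v S. ones_weight q S c)
      = (\<Sum>T\<in>Pow S. (\<Sum>f\<in>parking_maps m (\<lambda>_. 0) T. ones_weight q T f) * of_nat (card (?G T)))"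
  proof (rule sum_ones_weight_decompose [OF fin])
    fix T :: "'a set" and f g :: "'a \<Rightarrow> nat"
    assume T: "T \<subseteq> S" and f: "f \<in> parking_maps m (\<lambda>_. 0) T" and g: "g \<in> (S - T) \<rightarrow>\<^sub>E {1..}"
    show "glue (1 + card T * m) S T f g \<in> parking_maps m v S \<longleftrightarrow> g \<in> ?G T"
    proof (cases "?ok T")
      case True
      show ?thesis
        unfolding if_P [OF True] by (rule glue_in_parking_maps_iff [OF fin v T True f g])
    next
      case False
      then have "T \<noteq> S" "v (card T) = 0" by auto
      then show ?thesis
        unfolding if_not_P [OF False] using glue_notin_parking_maps [OF fin T _ _ g] by blast
    qed
  next
    fix T
    show "finite (?G T)"
      using fin by (simp add: finite_parking_maps)
  next
    fix T
    show "?G T \<subseteq> (S - T) \<rightarrow>\<^sub>E {1..}"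
      using parking_maps_subset by (cases "?ok T") (simp_all only: if_True if_False empty_subsetI)
  qed (rule parking_maps_subset)
  also have "\<dots> = (\<Sum>T\<in>Pow S. if ?ok T then abel_poly (of_nat m) q (card T) *
        of_nat (card (parking_maps m (\<lambda>i. v (i + card T) - 1) (S - T))) else 0)"
  proof (intro sum.cong refl)
    fix T assume "T \<in> Pow S"
    then have "finite T" using fin by (auto intro: finite_subset)
    then show "(\<Sum>f\<in>parking_maps m (\<lambda>_. 0) T. ones_weight q T f) * of_nat (card (?G T))
      = (if ?ok T then abel_poly (of_nat m) q (card T) *
        of_nat (card (parking_maps m (\<lambda>i. v (i + card T) - 1) (S - T))) else 0)"
      by (cases "?ok T") (simp_all only: sum_ones_weight_parking_maps if_True if_False card.empty of_nat_0 mult_zero_right)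
  qed
  also have "\<dots> = (\<Sum>T | T \<in> Pow S \<and> ?ok T. abel_poly (of_nat m) q (card T) *
        of_nat (card (parking_maps m (\<lambda>i. v (i + card T) - 1) (S - T))))"
    using fin by (intro sum.inter_filter [symmetric]) simp
  finally show ?thesis by simp
qed

section \<open>Staircase bounds\<close>

text \<open>The possible tails of a list in \<^const>\<open>spec\<close> after \<open>t\<close> entries with sum \<open>r\<close>.\<close>
definition spec_from :: "nat \<Rightarrow> nat \<Rightarrow> nat \<Rightarrow> nat \<Rightarrow> nat list set" where
  "spec_from b t d r = {J. length J = d \<and> (\<forall>k\<in>{1..d}. (t + k) * b \<le> r + sum_list (take k J)) \<and>
     r + sum_list J = (t + d) * b}"

lemma spec_eq_spec_from: "spec d b = spec_from b 0 d 0"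
  by (simp add: spec_def spec_from_def)

lemma finite_spec_from: "finite (spec_from b t d r)"
proof (rule finite_subset)
  show "spec_from b t d r \<subseteq> {J. set J \<subseteq> {..(t + d) * b} \<and> length J = d}"
    using member_le_sum_list by (fastforce simp: spec_from_def)
  show "finite {J. set J \<subseteq> {..(t + d) * b} \<and> length J = d}"
    by (rule finite_lists_length_eq) simp
qed

lemma spec_from_0: "spec_from b t 0 r = (if r = t * b then {[]} else {})"
  by (auto simp: spec_from_def)

lemma Cons_in_spec_from_iff:
  "j # J \<in> spec_from b t (Suc d) r \<longleftrightarrow> Suc t * b \<le> r + j \<and> J \<in> spec_from b (Suc t) d (r + j)"
proof -
  have *: "{1..Suc d} = insert 1 (Suc ` {1..d})"
    by (auto simp: image_Suc_atLeastAtMost)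
  have "(\<forall>k\<in>{1..Suc d}. (t + k) * b \<le> r + sum_list (take k (j # J)))
      \<longleftrightarrow> Suc t * b \<le> r + j \<and> (\<forall>k\<in>{1..d}. (Suc t + k) * b \<le> r + j + sum_list (take k J))"
    unfolding * by (simp add: algebra_simps del: image_Suc_atLeastAtMost)
  then show ?thesis
    by (auto simp: spec_from_def add.assoc)
qed

text \<open>The entries still to come add up to \<open>n\<close>, so the first one ranges over the
  possible sizes of a subset of an \<open>n\<close>-element set.\<close>

lemma sum_spec_from_Suc:
  fixes h :: "nat list \<Rightarrow> 'b::comm_monoid_add"
  assumes "r + n = (t + Suc d) * b"
  shows "sum h (spec_from b t (Suc d) r)
    = (\<Sum>j | j \<le> n \<and> Suc t * b \<le> r + j. \<Sum>J\<in>spec_from b (Suc t) d (r + j). h (j # J))"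
proof -
  have "(\<Sum>j | j \<le> n \<and> Suc t * b \<le> r + j. \<Sum>J\<in>spec_from b (Suc t) d (r + j). h (j # J))
      = (\<Sum>(j, J)\<in>(SIGMA j:{j. j \<le> n \<and> Suc t * b \<le> r + j}. spec_from b (Suc t) d (r + j)). h (j # J))"
    by (rule sum.Sigma) (auto simp: finite_spec_from)
  also have "\<dots> = sum h (spec_from b t (Suc d) r)"
  proof (rule sum.reindex_bij_witness [where i = "\<lambda>J. (hd J, tl J)" and j = "\<lambda>(j, J). j # J"])
    fix J assume J: "J \<in> spec_from b t (Suc d) r"
    then obtain j K where JK: "J = j # K"
      by (cases J) (auto simp: spec_from_def)
    have "r + sum_list J = r + n"
      using J assms by (simp add: spec_from_def)
    then have "j \<le> n"
      using JK by simp
    then show "(hd J, tl J) \<in> (SIGMA j:{j. j \<le> n \<and> Suc t * b \<le> r + j}. spec_from b (Suc t) d (r + j))"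
      using J unfolding JK Cons_in_spec_from_iff by simp
    show "(case (hd J, tl J) of (j, J) \<Rightarrow> j # J) = J"
      by (simp add: JK)
  qed (auto simp: Cons_in_spec_from_iff)
  finally show ?thesis ..
qed

text \<open>Removes one block. The count of the remainder is an assumption with arbitrary weight
  \<open>w\<close>, so that the step serves both the induction at \<open>q = 1\<close> and the first
  block with the indeterminate.\<close>

lemma sum_ones_weight_parking_maps_Suc:
  fixes q :: "'b::{idom, ring_char_0}" and S :: "'a set"
  assumes b: "b > 0" and fin: "finite S" and r: "r + card S = (t + Suc d) * b"
    and IH: "\<And>r' (T :: 'a set). finite T \<Longrightarrow> r' + card T = (Suc t + d) * b \<Longrightarrow> Suc t * b \<le> r' \<Longrightarrow>
      of_nat (card (parking_maps m (\<lambda>i. (i + r') div b - Suc t) T))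
        = (\<Sum>J\<in>spec_from b (Suc t) d r'. of_nat (multinomial (card T) J) * w J :: 'b)"
  shows "(\<Sum>c\<in>parking_maps m (\<lambda>i. (i + r) div b - t) S. ones_weight q S c)
    = (\<Sum>J\<in>spec_from b t (Suc d) r.
        of_nat (multinomial (card S) J) * abel_poly (of_nat m) q (hd J) * w (tl J))"
proof -
  let ?v = "\<lambda>i. (i + r) div b - t"
  let ?n = "card S"
  let ?A = "abel_poly (of_nat m) q"
  let ?X = "\<lambda>j. \<Sum>J\<in>spec_from b (Suc t) d (r + j). of_nat (multinomial (?n - j) J) * w J"
  have mono: "mono ?v"
    by (intro monoI diff_le_mono div_le_mono) simp
  \<comment> \<open>For \<open>T = S\<close> the inequality follows from \<open>r\<close>, so both
    alternatives merge into the partial sum condition of \<open>spec_from\<close>.\<close>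
  have ok: "T = S \<or> 1 \<le> ?v (card T) \<longleftrightarrow> Suc t * b \<le> r + card T" if "T \<subseteq> S" for T
  proof -
    have "1 \<le> ?v (card T) \<longleftrightarrow> Suc t * b \<le> r + card T"
      using less_eq_div_iff_mult_less_eq [OF b, of "Suc t" "card T + r"]
      by (simp add: Suc_le_eq add.commute less_diff_conv)
    moreover have "Suc t * b \<le> r + card S"
      unfolding r by (intro mult_le_mono1) simp
    ultimately show ?thesis by auto
  qed
  \<comment> \<open>The bounds keep their shape: \<open>r\<close> grows by the block size and
    \<open>t\<close> by one.\<close>
  have shift: "(\<lambda>i. ?v (i + k) - 1) = (\<lambda>i. (i + (r + k)) div b - Suc t)" for k
    by (simp add: add_ac)
  have "(\<Sum>c\<in>parking_maps m ?v S. ones_weight q S c)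
      = (\<Sum>T | T \<in> Pow S \<and> Suc t * b \<le> r + card T. ?A (card T) *
          of_nat (card (parking_maps m (\<lambda>i. (i + (r + card T)) div b - Suc t) (S - T))))"
    unfolding sum_ones_weight_parking_maps_rec [OF fin mono] shift
    by (rule sum.cong) (use ok in auto)
  also have "\<dots> = (\<Sum>T | T \<in> Pow S \<and> Suc t * b \<le> r + card T. ?A (card T) * ?X (card T))"
  proof (intro sum.cong refl)
    fix T assume "T \<in> {T. T \<in> Pow S \<and> Suc t * b \<le> r + card T}"
    then have T: "T \<subseteq> S" "finite T" "Suc t * b \<le> r + card T" "card T \<le> ?n"
      using fin by (auto intro: finite_subset card_mono)
    then have card: "card (S - T) = ?n - card T"
      by (simp add: card_Diff_subset)
    have "r + card T + card (S - T) = (Suc t + d) * b"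
      using card T(4) r by simp
    from IH [OF _ this T(3)] fin
    show "?A (card T) * of_nat (card (parking_maps m (\<lambda>i. (i + (r + card T)) div b - Suc t) (S - T)))
        = ?A (card T) * ?X (card T)"
      by (simp add: card)
  qed
  also have "\<dots> = (\<Sum>T\<in>Pow S. if Suc t * b \<le> r + card T then ?A (card T) * ?X (card T) else 0)"
    using fin by (intro sum.inter_filter) simp
  also have "\<dots> = (\<Sum>j\<le>?n. of_nat (?n choose j) * (if Suc t * b \<le> r + j then ?A j * ?X j else 0))"
    by (rule sum_Pow_card [OF fin])
  also have "\<dots> = (\<Sum>j\<le>?n. if Suc t * b \<le> r + j then of_nat (?n choose j) * (?A j * ?X j) else 0)"
    by (intro sum.cong refl) simp
  also have "\<dots> = (\<Sum>j | j \<in> {..?n} \<and> Suc t * b \<le> r + j. of_nat (?n choose j) * (?A j * ?X j))"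
    by (intro sum.inter_filter [symmetric]) simp
  also have "\<dots> = (\<Sum>j | j \<le> ?n \<and> Suc t * b \<le> r + j. \<Sum>J\<in>spec_from b (Suc t) d (r + j).
      of_nat (multinomial ?n (j # J)) * ?A (hd (j # J)) * w (tl (j # J)))"
  proof (rule sum.cong)
    fix j assume "j \<in> {j. j \<le> ?n \<and> Suc t * b \<le> r + j}"
    then have j: "j \<le> ?n" by simp
    have "multinomial ?n (j # J) = (?n choose j) * multinomial (?n - j) J"
      if "J \<in> spec_from b (Suc t) d (r + j)" for J
    proof -
      have "r + j + sum_list J = r + ?n"
        using that r by (simp add: spec_from_def)
      then have "?n = sum_list (j # J)" "?n - j = sum_list J" by simp_all
      then show ?thesis using multinomial_Cons [of j J] by simp
    qed
    then show "of_nat (?n choose j) * (?A j * ?X j) = (\<Sum>J\<in>spec_from b (Suc t) d (r + j).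
      of_nat (multinomial ?n (j # J)) * ?A (hd (j # J)) * w (tl (j # J)))"
      by (simp add: sum_distrib_left mult_ac)
  qed simp
  also have "\<dots> = (\<Sum>J\<in>spec_from b t (Suc d) r.
        of_nat (multinomial ?n J) * ?A (hd J) * w (tl J))"
    by (rule sum_spec_from_Suc [OF r, symmetric])
  finally show ?thesis .
qed

text \<open>Here \<open>r\<close> is the total size of the \<open>t\<close> blocks already removed.
  With \<open>t * b <= r\<close> the subtraction of \<open>t\<close> is never truncated, and for
  \<open>d = 0\<close> it forces \<open>S\<close> to be empty.\<close>

lemma card_parking_maps_staircase:
  fixes S :: "'a set"
  assumes "b > 0" "finite S" "r + card S = (t + d) * b" "t * b \<le> r"
  shows "of_nat (card (parking_maps m (\<lambda>i. (i + r) div b - t) S))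
    = (\<Sum>J\<in>spec_from b t d r. of_nat (multinomial (card S) J) *
        (\<Prod>j\<leftarrow>J. abel_poly (of_nat m) 1 j) :: 'b::{idom, ring_char_0})"
  using assms
proof (induction d arbitrary: r t S)
  case 0
  then have "r + card S = t * b" by simp
  with 0(4) have "card S = 0" "r = t * b" by linarith+
  then have "S = {}" "r = t * b" using 0 by simp_all
  then show ?case
    by (simp add: spec_from_0 multinomial_def)
next
  case (Suc d)
  have "J \<noteq> []" if "J \<in> spec_from b t (Suc d) r" for J
    using that by (auto simp: spec_from_def)
  then have prod: "(\<Prod>j\<leftarrow>J. abel_poly (of_nat m) 1 j)
      = abel_poly (of_nat m) 1 (hd J) * (\<Prod>j\<leftarrow>tl J. abel_poly (of_nat m) (1 :: 'b) j)"
    if "J \<in> spec_from b t (Suc d) r" for J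
    using that by (cases J) auto
  have "(\<Sum>c\<in>parking_maps m (\<lambda>i. (i + r) div b - t) S. ones_weight (1 :: 'b) S c)
    = (\<Sum>J\<in>spec_from b t (Suc d) r. of_nat (multinomial (card S) J) *
        abel_poly (of_nat m) 1 (hd J) * (\<Prod>j\<leftarrow>tl J. abel_poly (of_nat m) 1 j))"
    using Suc by (intro sum_ones_weight_parking_maps_Suc) auto
  then show ?case
    by (simp add: prod mult.assoc)
qed

section \<open>From lists to maps, and the rational bounds\<close>

lemma sum_ones_parking_functions:
  fixes q :: "'b::comm_semiring_1"
  assumes u: "\<And>i. i < n \<Longrightarrow> u i = 1 + i * m + v i"
  shows "(\<Sum>c\<in>parking_functions n u. q ^ ones c)
    = (\<Sum>c\<in>parking_maps m v {..<n}. ones_weight q {..<n} c)"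
proof -
  define tofun where "tofun c = restrict (nth c) {..<n}" for c :: "nat list"
  have len: "length c = n" if "c \<in> parking_functions n u" for c
    using that by (simp add: parking_functions_def)
  have in_iff: "tofun c \<in> parking_maps m v {..<n} \<longleftrightarrow> c \<in> parking_functions n u" if "length c = n" for c
  proof -
    have "{s \<in> {..<n}. tofun c s \<le> 1 + i * m + v i} = {k. k < length c \<and> c ! k \<le> u i}" if "i < n" for i
      using \<open>length c = n\<close> u [OF that] by (auto simp: tofun_def)
    then have "(\<forall>i<n. i < card {s \<in> {..<n}. tofun c s \<le> 1 + i * m + v i}) \<longleftrightarrow> (\<forall>i<n. sort c ! i \<le> u i)"
      using that by (simp add: sort_nth_le_iff)
    moreover have "tofun c \<in> {..<n} \<rightarrow>\<^sub>E {1..} \<longleftrightarrow> (\<forall>x\<in>set c. 1 \<le> x)"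
      using that by (auto simp: tofun_def all_set_conv_all_nth)
    ultimately show ?thesis
      using that by (simp add: parking_maps_def parking_functions_def)
  qed
  have tofun_map: "tofun (map f [0..<n]) = f" if "f \<in> parking_maps m v {..<n}" for f
  proof
    fix i
    have "f \<in> {..<n} \<rightarrow>\<^sub>E {1..}"
      using that parking_maps_subset by blast
    from PiE_arb [OF this, of i] show "tofun (map f [0..<n]) i = f i"
      by (cases "i < n") (auto simp: tofun_def)
  qed
  have weight: "ones_weight q {..<n} (tofun c) = q ^ ones c" if "length c = n" for c
  proof -
    have "ones_weight q {..<n} (tofun c) = (\<Prod>x\<leftarrow>c. if x = 1 then q else 1)"
      using that
      by (simp add: ones_weight_def tofun_def prod.list_conv_set_nth atLeast0LessThan)
    also have "\<dots> = q ^ ones c"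
      unfolding ones_def by (induction c) auto
    finally show ?thesis .
  qed
  show ?thesis
  proof (rule sum.reindex_bij_witness [where i = "\<lambda>f. map f [0..<n]" and j = tofun])
    fix c assume "c \<in> parking_functions n u"
    then have c: "length c = n" by (rule len)
    then show "map (tofun c) [0..<n] = c"
      by (intro nth_equalityI) (auto simp: tofun_def)
    show "tofun c \<in> parking_maps m v {..<n}"
      using in_iff [OF c] \<open>c \<in> _\<close> by simp
    show "ones_weight q {..<n} (tofun c) = q ^ ones c"
      by (rule weight [OF c])
  next
    fix f assume f: "f \<in> parking_maps m v {..<n}"
    then show "tofun (map f [0..<n]) = f"
      by (rule tofun_map)
    show "map f [0..<n] \<in> parking_functions n u"
      using in_iff [of "map f [0..<n]"] f by (simp add: tofun_map)
  qed
qed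

text \<open>The slope is \<open>m + 1 / b\<close>, and the integer \<open>i * m\<close> can be
  pulled out of the floor.\<close>

lemma rational_bound_eq:
  assumes "b > 0" "a = m * b + 1"
  shows "rational_bound a b i = 1 + i * m + i div b"
proof -
  have "real i * (real a / real b) = real i / real b + of_int (int (i * m))"
    using assms by (simp add: field_simps)
  then have "\<lfloor>real i * (real a / real b)\<rfloor> = \<lfloor>real i / real b\<rfloor> + int (i * m)"
    by (metis floor_add_int)
  also have "\<dots> = int (i div b + i * m)"
    by (simp add: floor_divide_of_nat_eq)
  finally show ?thesis
    unfolding rational_bound_def by (simp only: nat_int)
qed

theorem theorem2p4:
  fixes a b d :: nat
  assumes "a > 0" and "b > 0" and "d > 0"
    and "[a = 1] (mod b)"
  shows "let q = [:0, 1:] :: rat poly;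
             m = [:(of_nat a - 1) / of_nat b:] :: rat poly
         in (\<Sum>c\<in>parking_functions (d * b) (rational_bound a b). q ^ ones c) =
            (\<Sum>J\<in>spec d b.
               of_nat (multinomial (d * b) J) *
               (q * (q + of_nat (J ! 0) * m) ^ (J ! 0 - 1)) *
               (\<Prod>t=2..d. (1 + of_nat (J ! (t - 1)) * m) ^ (J ! (t - 1) - 1)))"
proof -
  define q where "q = ([:0, 1:] :: rat poly)"
  have "b dvd a - 1"
    using assms(1,4) by (simp add: cong_altdef_nat)
  then obtain m where "a - 1 = m * b"
    by (metis dvd_div_mult_self)
  then have a: "a = m * b + 1"
    using assms(1) by simp
  have m: "[:(of_nat a - 1) / of_nat b:] = (of_nat m :: rat poly)"
    using assms(2) by (simp add: a of_nat_poly)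
  obtain d' where d: "d = Suc d'"
    using assms(3) by (cases d) auto
  \<comment> \<open>The zeros are the starting values of \<open>r\<close> and
    \<open>t\<close>.\<close>
  have "(\<Sum>c\<in>parking_functions (d * b) (rational_bound a b). q ^ ones c)
      = (\<Sum>c\<in>parking_maps m (\<lambda>i. (i + 0) div b - 0) {..<d * b}. ones_weight q {..<d * b} c)"
    by (rule sum_ones_parking_functions) (simp add: rational_bound_eq [OF assms(2) a])
  \<comment> \<open>The indeterminate weights the first block only; all later blocks are counted at
    weight \<open>1\<close>.\<close>
  also have "\<dots> = (\<Sum>J\<in>spec_from b 0 (Suc d') 0. of_nat (multinomial (card {..<d * b}) J) *
      abel_poly (of_nat m) q (hd J) * (\<Prod>j\<leftarrow>tl J. abel_poly (of_nat m) 1 j))"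
    using assms(2) by (intro sum_ones_weight_parking_maps_Suc card_parking_maps_staircase) (auto simp: d)
  also have "\<dots> = (\<Sum>J\<in>spec d b. of_nat (multinomial (d * b) J) *
      (q * (q + of_nat (J ! 0) * of_nat m) ^ (J ! 0 - 1)) *
      (\<Prod>t=2..d. (1 + of_nat (J ! (t - 1)) * of_nat m) ^ (J ! (t - 1) - 1)))"
    unfolding spec_eq_spec_from d
  proof (rule sum.cong [OF refl])
    fix J assume J: "J \<in> spec_from b 0 (Suc d') 0"
    then obtain j K where JK: "J = j # K"
      by (cases J) (auto simp: spec_from_def)
    have len: "length K = d'"
      using J by (simp add: JK spec_from_def)
    \<comment> \<open>The first entry is positive, so \<open>abel_poly\<close> at \<open>q\<close>
      takes its second branch.\<close>
    have "b \<le> j"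
      using J unfolding JK Cons_in_spec_from_iff by simp
    then have j: "j \<noteq> 0"
      using assms(2) by simp
    \<comment> \<open>At weight \<open>1\<close> both branches agree: for \<open>i = 0\<close> the
      truncated exponent is \<open>0\<close>.\<close>
    have abel1: "abel_poly (of_nat m) 1 i = (1 + of_nat i * of_nat m :: rat poly) ^ (i - 1)" for i
      by (simp add: abel_poly_def)
    have "(\<Prod>i\<leftarrow>K. abel_poly (of_nat m) 1 i)
        = (\<Prod>i<d'. (1 + of_nat (K ! i) * of_nat m :: rat poly) ^ (K ! i - 1))"
      by (simp add: prod.list_conv_set_nth abel1 len atLeast0LessThan)
    also have "\<dots> = (\<Prod>t=2..Suc d'. (1 + of_nat (J ! (t - 1)) * of_nat m) ^ (J ! (t - 1) - 1))"
      \<comment> \<open>The index \<open>t\<close> counts entries of \<open>J\<close> from one and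
        starts at the second, so it corresponds to position \<open>t - 2\<close> in
        \<open>K\<close>.\<close>
      by (rule prod.reindex_bij_witness [where i = "\<lambda>t. t - 2" and j = "\<lambda>i. i + 2"])
         (auto simp: JK)
    finally show "of_nat (multinomial (card {..<Suc d' * b}) J) *
        abel_poly (of_nat m) q (hd J) * (\<Prod>j\<leftarrow>tl J. abel_poly (of_nat m) 1 j)
      = of_nat (multinomial (Suc d' * b) J) *
        (q * (q + of_nat (J ! 0) * of_nat m) ^ (J ! 0 - 1)) *
        (\<Prod>t=2..Suc d'. (1 + of_nat (J ! (t - 1)) * of_nat m) ^ (J ! (t - 1) - 1))"
      using j by (simp add: JK abel_poly_def)
  qed
  finally show ?thesis
    unfolding Let_def m q_def .
qed

end
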